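(* For every integer $n \ge 0$, $$F_{n+4} = H_n + n + 3,$$ where $(F_n)_{n\ge 0}$ is the Fibonacci sequence and $H_n = \sum_{i=0}^n (n+1-i)F_i$.
   Context: The Fibonacci sequence is defined by $F_0 = 0$, $F_1 = 1$, and $F_n = F_{n-1}+F_{n-2}$ for $n \ge 2$. The sequence $(H_n)_{n\ge 0}$ is obtained by applying the partial sum operator twice to the Fibonacci sequence, that is, $H_n = \sum_{i=0}^n (n+1-i)F_i$; its first terms are $0,1,3,7,14,26,46$. *)

theory Defs
  imports "HOL-Number_Theory.Fib"
begin

text \<open>Twice iterated partial sums of the Fibonacci numbers, as a single weighted sum. The subtraction on
  \<^typ>\<open>nat\<close> never truncates, because the index satisfies \<open>i \<le> n\<close>.\<close>

definition H :: "nat \<Rightarrow> nat" where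
  "H n = (\<Sum>i=0..n. (n + 1 - i) * fib i)"

end

theory Submission
  imports Defs
begin

text \<open>Passing from \<open>n\<close> to \<open>Suc n\<close> raises every weight in \<open>H\<close> by one, so \<open>H\<close> grows by a plain partial sum
  of Fibonacci numbers (\<open>H_Suc\<close>). That partial sum is again a Fibonacci number minus one (\<open>sum_fib\<close>), by
  telescoping. Summing this a second time therefore yields a Fibonacci number once more, up to the
  correction \<open>n + 3\<close>: each step contributes one to it, starting from \<open>fib 4 = 3\<close> and \<open>H 0 = 0\<close>.\<close>

lemma sum_fib: "(\<Sum>i=0..n. fib i) + 1 = fib (n + 2)"
  by (induction n) simp_all

lemma H_Suc: "H (Suc n) = H n + (\<Sum>i=0..Suc n. fib i)"
proof -
  have "(\<Sum>i=0..n. (Suc n + 1 - i) * fib i) = (\<Sum>i=0..n. (n + 1 - i) * fib i + fib i)"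
    by (rule sum.cong) (simp_all add: Suc_diff_le)
  then show ?thesis
    by (simp add: H_def sum.distrib)
qed

theorem proposition1p5:
  fixes n :: nat
  shows "fib (n + 4) = H n + n + 3"
proof (induction n)
  case 0
  show ?case
    by (simp add: H_def numeral_eq_Suc)
next
  case (Suc n)
  have "fib (Suc n + 4) = fib (n + 4) + fib (Suc n + 2)"
    by (simp add: numeral_eq_Suc)
  also have "\<dots> = (H n + n + 3) + ((\<Sum>i=0..Suc n. fib i) + 1)"
    by (simp only: Suc.IH sum_fib)
  also have "\<dots> = H (Suc n) + Suc n + 3"
    by (simp add: H_Suc)
  finally show ?case .
qed

end
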